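(* Let $Z$ be a Banach space over $\mathbb{K}$, let $u\in S_Z$, and let $\Lambda\subset B_{Z^*}$ be one-norming for $Z$. Then the following are equivalent: (i) $u$ is a smooth point of $Z$; (ii) $\{\theta_0\lim\psi_n(z)\colon \psi_n\in\Lambda\ \forall n\in\mathbb{N},\ \theta_0\in\mathbb{T},\ \lim\psi_n(u)=\overline{\theta_0}\}$ is a singleton for every $z\in Z$; (iii) $\{\lim\psi_n(z)\overline{\psi_n(u)}\colon \psi_n\in\Lambda\ \forall n\in\mathbb{N},\ \lim|\psi_n(u)|=1\}$ is a singleton for every $z\in Z$; (iv) $\bigcap_{\delta>0}\overline{\{\psi(z)\overline{\psi(u)}\colon \psi\in\Lambda,\ |\psi(u)|>1-\delta\}}$ is a singleton for every $z\in Z$; (v) $\bigcap_{\delta>0}\operatorname{conv}\Bigl(\overline{\{\psi(z)\overline{\psi(u)}\colon \psi\in\Lambda,\ |\psi(u)|>1-\delta\}}\Bigr)$ is a singleton for every $z\in Z$.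
   Context: $\mathbb{K}$ is $\mathbb{R}$ or $\mathbb{C}$, $\mathbb{T}$ is the set of modulus-one scalars of $\mathbb{K}$. $B_Z$ and $S_Z$ are the closed unit ball and unit sphere of $Z$, $Z^*$ is the topological dual. A point $z\in Z$ is a smooth point of $Z$ if $\{\phi\in S_{Z^*}\colon \phi(z)=\|z\|\}$ is a singleton. A subset $\Lambda\subset B_{Z^*}$ is one-norming for $Z$ if $\|z\|=\sup\{|\phi(z)|\colon \phi\in\Lambda\}$ for all $z\in Z$. $\operatorname{conv}$ is the convex hull; a bar over a set of scalars is its closure, and a bar over a scalar is complex conjugation. Writing $\lim a_n$ for a bounded scalar sequence means that the sequence is required to be convergent. *)

theory Defs
  imports "HOL-Analysis.Analysis"
begin

text \<open>
  The scalar field is \<open>\<real>\<close> or \<open>\<complex>\<close>, treated uniformly: a real normed field with a conjugation.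
  The two axioms leave no other possibilities, see \<open>rc_field_cases\<close> and \<open>norm_rc_field\<close> below.
\<close>

class rc_field = real_normed_field +
  fixes kcnj :: "'a \<Rightarrow> 'a"
  assumes kcnj_add: "kcnj (x + y) = kcnj x + kcnj y"
    and mult_kcnj_scaleR: "x * kcnj x = (norm x)\<^sup>2 *\<^sub>R 1"

instantiation real :: rc_field
begin
definition kcnj_real :: "real \<Rightarrow> real" where "kcnj_real x = x"
instance by standard (auto simp: kcnj_real_def power2_eq_square)
end

instantiation complex :: rc_field
begin
definition kcnj_complex :: "complex \<Rightarrow> complex" where "kcnj_complex = cnj"
instance by standard (auto simp: kcnj_complex_def scaleR_conv_of_real simp flip: complex_norm_square)
end

lemma mult_kcnj: "x * kcnj x = of_real ((norm x)\<^sup>2)" for x :: "'a::rc_field"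
  by (simp add: mult_kcnj_scaleR of_real_def)

lemma kcnj_of_real: "kcnj (of_real r :: 'a::rc_field) = of_real r"
proof (cases "r = 0")
  case True
  then show ?thesis using kcnj_add[of "0::'a" 0] by simp
next
  case False
  have "of_real r * kcnj (of_real r :: 'a) = of_real r * of_real r"
    by (simp add: mult_kcnj power2_eq_square)
  with False show ?thesis by simp
qed

lemma add_kcnj: "\<exists>t. x + kcnj x = (of_real t :: 'a::rc_field)"
proof -
  have "(x + 1) * (kcnj x + 1) = of_real ((norm (x + 1))\<^sup>2)"
    using mult_kcnj[of "x + 1"] kcnj_add[of x 1] kcnj_of_real[of 1, where 'a='a] by simp
  then have "x + kcnj x = of_real ((norm (x + 1))\<^sup>2 - (norm x)\<^sup>2 - 1)"
    using mult_kcnj[of x] by (simp add: algebra_simps)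
  then show ?thesis by blast
qed

lemma rc_field_sqrt:
  fixes x :: "'a::rc_field"
  assumes "x \<notin> \<real>"
  shows "\<exists>a b i. i * i = -1 \<and> kcnj i = - i \<and> x = of_real a + of_real b * i"
proof -
  obtain t where t: "x + kcnj x = of_real t" using add_kcnj by blast
  define y where "y = x - of_real (t / 2)"
  have x: "x = of_real (t / 2) + y" by (simp add: y_def)
  have "kcnj x = of_real (t / 2) + kcnj y"
    by (subst x) (simp add: kcnj_add kcnj_of_real del: of_real_divide)
  with t x have c: "kcnj y = - y"
  proof -
    have "of_real t = of_real (t / 2) + of_real (t / 2 :: real) + (y + kcnj y)"
      using t x \<open>kcnj x = _\<close> by (metis add.assoc add.left_commute)
    also have "of_real (t / 2) + of_real (t / 2 :: real) = (of_real t :: 'a)"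
      by (simp flip: of_real_add)
    finally have "y + kcnj y = 0" by simp
    then show ?thesis by (simp add: add_eq_0_iff)
  qed
  have y0: "y \<noteq> 0" using assms x by auto
  define n where "n = norm y"
  have n: "n \<noteq> 0" using y0 by (simp add: n_def)
  have yy: "y * y = - of_real (n\<^sup>2)"
    by (metis mult_kcnj[of y] c n_def mult_minus_right minus_minus)
  define i where "i = of_real (1 / n) * y"
  have y: "y = of_real n * i" using n by (simp add: i_def)
  have ii: "i * i = -1"
  proof -
    have "i * i = of_real (1 / n * (1 / n)) * (y * y)" by (simp add: i_def)
    also have "\<dots> = - of_real (1 / n * (1 / n) * n\<^sup>2)" by (simp add: yy)
    also have "\<dots> = -1" using n by (simp add: power2_eq_square)
    finally show ?thesis .
  qed
  have "norm i = 1" using n by (simp add: i_def norm_divide n_def)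
  then have "i * kcnj i = i * (- i)" using mult_kcnj[of i] ii by simp
  moreover have "i \<noteq> 0" using ii by auto
  ultimately have "kcnj i = - i" using mult_left_cancel by blast
  with ii x y show ?thesis by blast
qed

lemma rc_field_cases:
  obtains "\<And>x::'a::rc_field. x \<in> \<real>"
  | i :: "'a::rc_field" where "i * i = -1" "kcnj i = - i"
      "\<And>x. \<exists>a b. x = of_real a + of_real b * i"
proof (cases "\<forall>x::'a. x \<in> \<real>")
  case True
  then show ?thesis using that(1) by blast
next
  case False
  then obtain i :: 'a where i: "i * i = -1" "kcnj i = - i" using rc_field_sqrt by blast
  have "\<exists>a b. x = of_real a + of_real b * i" for x
  proof (cases "x \<in> \<real>")
    case True
    then obtain a where "x = of_real a" by (auto elim: Reals_cases)
    then have "x = of_real a + of_real 0 * i" by simp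
    then show ?thesis by blast
  next
    case False
    then obtain a b j where j: "j * j = -1" "x = of_real a + of_real b * j"
      using rc_field_sqrt by blast
    have "(j - i) * (j + i) = 0" using i j by (simp add: algebra_simps)
    then have "j = i \<or> j = - i" by (auto simp: add_eq_0_iff2)
    then have "x = of_real a + of_real b * i \<or> x = of_real a + of_real (- b) * i"
      using j by auto
    then show ?thesis by blast
  qed
  with i that(2) show ?thesis by blast
qed

lemma norm_rc_field:
  fixes i :: "'a::rc_field"
  assumes "i * i = -1" "kcnj i = - i"
  shows "norm (of_real a + of_real b * i) = sqrt (a\<^sup>2 + b\<^sup>2)"
proof -
  let ?x = "of_real a + of_real b * i"
  have "norm (i * i) = 1" unfolding assms(1) by simp
  then have "(norm i)\<^sup>2 = 1" by (simp add: norm_mult power2_eq_square)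
  then have ni: "norm i = 1" by (smt (verit) power2_eq_1_iff norm_ge_zero)
  have k: "kcnj (of_real b * i) = - (of_real b * i)"
  proof (cases "b = 0")
    case True
    then show ?thesis using kcnj_of_real[of 0, where 'a='a] by simp
  next
    case False
    have "of_real b * i * kcnj (of_real b * i) = of_real (b\<^sup>2)"
      using mult_kcnj[of "of_real b * i"] by (simp add: norm_mult ni)
    also have "\<dots> = of_real b * i * - (of_real b * i)"
    proof -
      have "of_real b * i * - (of_real b * i) = - ((of_real b * of_real b) * (i * i))"
        by (simp add: ac_simps)
      then show ?thesis unfolding assms(1) by (simp add: power2_eq_square)
    qed
    finally have "of_real b * i * kcnj (of_real b * i) = of_real b * i * - (of_real b * i)" .
    moreover have "of_real b * i \<noteq> 0" using False assms(1) by auto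
    ultimately show ?thesis using mult_left_cancel by blast
  qed
  have "of_real ((norm ?x)\<^sup>2) = ?x * (of_real a - of_real b * i)"
    using mult_kcnj[of ?x] k by (simp add: kcnj_add kcnj_of_real)
  also have "\<dots> = of_real (a\<^sup>2) - of_real (b\<^sup>2) * (i * i)"
    by (simp add: algebra_simps power2_eq_square)
  also have "\<dots> = of_real (a\<^sup>2 + b\<^sup>2)" using assms(1) by simp
  finally have "(norm ?x)\<^sup>2 = a\<^sup>2 + b\<^sup>2" using of_real_eq_iff by blast
  then show ?thesis by (simp add: real_sqrt_unique)
qed

text \<open>
  Banach spaces over the field \<open>'k\<close>. The class \<^class>\<open>banach\<close> supplies the norm, completeness and
  the underlying real space; \<open>smul_of_real\<close> ties the two scalar multiplications together.
\<close>

locale kbanach = vector_space smul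
  for smul :: "'k::rc_field \<Rightarrow> 'z::banach \<Rightarrow> 'z" +
  assumes smul_of_real: "smul (of_real r) z = r *\<^sub>R z"
    and norm_smul: "norm (smul c z) = norm c * norm z"

lemma kbanach_real: "kbanach ((*\<^sub>R) :: real \<Rightarrow> 'z::banach \<Rightarrow> 'z)"
  by unfold_locales (auto simp: algebra_simps)

lemma kbanach_complex: "kbanach ((*) :: complex \<Rightarrow> complex \<Rightarrow> complex)"
  by unfold_locales (auto simp: algebra_simps norm_mult scaleR_conv_of_real)

definition top_dual :: "('k::rc_field \<Rightarrow> 'z::banach \<Rightarrow> 'z) \<Rightarrow> ('z \<Rightarrow> 'k) set" where
  "top_dual smul = {\<phi>. Vector_Spaces.linear smul (*) \<phi> \<and> continuous_on UNIV \<phi>}"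

definition dual_ball :: "('k::rc_field \<Rightarrow> 'z::banach \<Rightarrow> 'z) \<Rightarrow> ('z \<Rightarrow> 'k) set" where
  "dual_ball smul = {\<phi> \<in> top_dual smul. onorm \<phi> \<le> 1}"

definition dual_sphere :: "('k::rc_field \<Rightarrow> 'z::banach \<Rightarrow> 'z) \<Rightarrow> ('z \<Rightarrow> 'k) set" where
  "dual_sphere smul = {\<phi> \<in> top_dual smul. onorm \<phi> = 1}"

definition smooth_point :: "('k::rc_field \<Rightarrow> 'z::banach \<Rightarrow> 'z) \<Rightarrow> 'z \<Rightarrow> bool" where
  "smooth_point smul z \<longleftrightarrow> is_singleton {\<phi> \<in> dual_sphere smul. \<phi> z = of_real (norm z)}"

text \<open>
  The supremum is taken in \<^typ>\<open>real\<close>: it is over a bounded set because \<open>\<Lambda>\<close> lies in the dual ball,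
  and \<open>\<Lambda> = {}\<close> is impossible in a nonzero space, since \<^term>\<open>norm\<close> is not constant there.
\<close>

definition one_norming :: "('k::rc_field \<Rightarrow> 'z::banach \<Rightarrow> 'z) \<Rightarrow> ('z \<Rightarrow> 'k) set \<Rightarrow> bool" where
  "one_norming smul \<Lambda> \<longleftrightarrow>
     \<Lambda> \<subseteq> dual_ball smul \<and> (\<forall>z. norm z = (SUP \<phi>\<in>\<Lambda>. norm (\<phi> z)))"

end

theory Submission
  imports Defs
begin

text \<open>
  Put \<open>g \<psi> z = \<psi> z * kcnj (\<psi> u)\<close> for \<open>\<psi> \<in> \<Lambda>\<close>. The sets in (ii), (iii), (iv) coincide, because scalar
  sequences have convergent subsequences. If the common set is a point, compactness puts the sets in
  (iv) for small \<open>\<delta>\<close> into small balls around it, which are convex, so (v) follows. If \<open>a\<close> is such a limit value at \<open>z\<close>, a Tychonoff cluster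
  point of the functionals \<open>g \<psi>\<^sub>n\<close> is a support functional at \<open>u\<close> taking the value \<open>a\<close> at \<open>z\<close>;
  hence smoothness gives (iii). Conversely, let \<open>p\<close> be the only limit value at \<open>z\<close>, let \<open>\<phi>\<close> be a
  support functional and \<open>w\<close> the multiple of \<open>z - p u\<close> by the conjugate of \<open>c = \<phi> (z - p u)\<close>. The
  functionals with \<open>|\<psi> u|\<close> close to 1 are small at \<open>w\<close>, and the others do not matter for the norm of
  \<open>u + s w\<close> when \<open>s\<close> is small, so that \<open>1 + s |c|\<^sup>2 = \<phi> (u + s w) \<le> \<parallel>u + s w\<parallel> \<le> 1 + o(s)\<close> and \<open>c = 0\<close>.
\<close>

section \<open>The scalar field\<close>

text \<open>Taking norms in \<open>x * kcnj x\<close> and cancelling \<open>norm x\<close> gives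
  this; zero, where nothing cancels, is covered by \<open>kcnj_of_real\<close>.\<close>

lemma norm_kcnj [simp]: "norm (kcnj x) = norm x" for x :: "'k::rc_field"
proof (cases "x = 0")
  case True
  then show ?thesis using kcnj_of_real[of 0, where 'a='k] by simp
next
  case False
  have "norm x * norm (kcnj x) = norm x * norm x"
    using arg_cong[OF mult_kcnj[of x], of norm] by (simp add: norm_mult power2_eq_square)
  with False show ?thesis by simp
qed

lemma kcnj_kcnj [simp]: "kcnj (kcnj x) = x" for x :: "'k::rc_field"
proof (cases "x = 0")
  case True
  then show ?thesis using kcnj_of_real[of 0, where 'a='k] by simp
next
  case False
  have "kcnj x * kcnj (kcnj x) = kcnj x * x"
    using mult_kcnj[of x] mult_kcnj[of "kcnj x"] by (simp add: mult.commute)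
  moreover have "kcnj x \<noteq> 0" using False norm_kcnj[of x] by (metis norm_eq_zero)
  ultimately show ?thesis by simp
qed

lemma kcnj_diff: "kcnj (x - y) = kcnj x - kcnj y" for x y :: "'k::rc_field"
  using kcnj_add[of "x - y" y] by simp

lemma tendsto_kcnj [tendsto_intros]:
  fixes f :: "'a \<Rightarrow> 'k::rc_field"
  assumes "(f \<longlongrightarrow> l) F"
  shows "((\<lambda>x. kcnj (f x)) \<longlongrightarrow> kcnj l) F"
  using assms unfolding tendsto_iff dist_norm by (simp flip: kcnj_diff)

text \<open>Over the reals the ball is the image of an interval; otherwise it is a closed subset of
  the image of a square under \<open>(a, b) \<mapsto> a + b i\<close>. The compactness arguments for
  scalar sequences and for functionals both rest on this.\<close>

lemma compact_cball_rc_field: "compact (cball (0::'k::rc_field) r)"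
proof (rule rc_field_cases[where 'a='k])
  assume real: "\<And>x::'k. x \<in> \<real>"
  have "cball (0::'k) r \<subseteq> of_real ` cball 0 r"
  proof
    fix x :: 'k
    assume x: "x \<in> cball 0 r"
    obtain a where "x = of_real a" using real[of x] by (auto elim: Reals_cases)
    with x show "x \<in> of_real ` cball 0 r" by auto
  qed
  moreover have "of_real ` cball 0 r \<subseteq> cball (0::'k) r" by auto
  moreover have "compact (of_real ` cball 0 r :: 'k set)"
    by (intro compact_continuous_image continuous_intros compact_cball)
  ultimately show ?thesis by (metis subset_antisym)
next
  fix i :: 'k
  assume i: "i * i = -1" "kcnj i = - i" and span: "\<And>x. \<exists>a b. x = of_real a + of_real b * i"
  define h where "h = (\<lambda>(a, b). of_real a + of_real b * i)"
  define Q where "Q = cball (0::real) r \<times> cball (0::real) r"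
  have "compact (h ` Q)"
    unfolding h_def Q_def case_prod_unfold
    by (intro compact_continuous_image continuous_intros compact_Times compact_cball)
  moreover have "cball 0 r \<subseteq> h ` Q"
  proof
    fix x :: 'k
    assume x: "x \<in> cball 0 r"
    obtain a b where ab: "x = of_real a + of_real b * i" using span by blast
    then have "sqrt (a\<^sup>2 + b\<^sup>2) \<le> r" using x norm_rc_field[OF i, of a b] by simp
    then have "(a, b) \<in> Q"
      using real_sqrt_sum_squares_ge1[of a b] real_sqrt_sum_squares_ge2[of b a]
      by (simp add: Q_def abs_le_iff) (smt (verit) real_sqrt_ge_abs1 real_sqrt_ge_abs2)
    with ab show "x \<in> h ` Q" unfolding h_def by (force intro: image_eqI[of _ _ "(a, b)"])
  qed
  ultimately show ?thesis by (metis closed_cball compact_Int_closed inf.absorb_iff2)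
qed

lemma bounded_seq_convergent_subseq:
  fixes f :: "nat \<Rightarrow> 'k::rc_field"
  assumes "\<And>n. norm (f n) \<le> B"
  shows "\<exists>l r. strict_mono r \<and> (f \<circ> r) \<longlonglongrightarrow> l"
  using compact_cball_rc_field[of B, where 'k='k] assms unfolding compact_def
  by (metis mem_cball_0)

section \<open>Functionals of norm at most one\<close>

text \<open>\<open>onorm\<close> is a supremum of reals and bounds the values of
  \<open>\<phi>\<close> only once the quotients are known to be bounded, so continuity at zero is
  turned into boundedness first. The pointwise inequality obtained here survives pointwise
  limits.\<close>

lemma (in kbanach) dual_ball_iff:
  "\<phi> \<in> dual_ball smul \<longleftrightarrow>
     Vector_Spaces.linear smul (*) \<phi> \<and> (\<forall>x. norm (\<phi> x) \<le> norm x)"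
proof (intro iffI conjI)
  assume \<phi>: "\<phi> \<in> dual_ball smul"
  then show lin: "Vector_Spaces.linear smul (*) \<phi>"
    by (simp add: dual_ball_def top_dual_def)
  interpret lin: Vector_Spaces.linear smul "(*)" \<phi> by (rule lin)
  have scaleR: "\<phi> (r *\<^sub>R x) = r *\<^sub>R \<phi> x" for r x
    using lin.scale[of "of_real r" x] by (simp add: smul_of_real scaleR_conv_of_real)
  have "continuous (at 0) \<phi>"
    using \<phi> by (simp add: dual_ball_def top_dual_def continuous_on_eq_continuous_at)
  then obtain d where d: "d > 0" "\<And>x. norm x < d \<Longrightarrow> norm (\<phi> x) < 1"
    unfolding continuous_at_eps_delta by (force simp: lin.zero dist_norm dest: spec[of _ 1])
  have "norm (\<phi> x) \<le> norm x * (2 / d)" for x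
  proof (cases "x = 0")
    case False
    \<comment> \<open>Rescaling \<open>x\<close> to norm \<open>d / 2\<close> brings it into the
      ball on which \<open>\<phi>\<close> is less than 1; this is the source of the bound
      \<open>2 / d\<close>.\<close>
    define t where "t = d / 2 / norm x"
    have t: "t > 0" using False d by (simp add: t_def)
    have "norm (t *\<^sub>R x) < d" using False d by (simp add: t_def)
    then have "t * norm (\<phi> x) < 1" using d(2)[of "t *\<^sub>R x"] t by (simp add: scaleR)
    then have "norm (\<phi> x) < 1 / t" using t by (simp add: field_simps)
    then show ?thesis by (simp add: t_def mult.commute)
  qed (simp add: lin.zero)
  then have bl: "bounded_linear \<phi>"
    by (intro bounded_linear_intro[where K = "2 / d"]) (auto simp: lin.add scaleR)
  have "onorm \<phi> \<le> 1" using \<phi> by (simp add: dual_ball_def)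
  then show "\<forall>x. norm (\<phi> x) \<le> norm x"
    using onorm[OF bl] by (meson mult_left_le_one_le norm_ge_zero onorm_pos_le[OF bl] order_trans)
next
  assume *: "Vector_Spaces.linear smul (*) \<phi> \<and> (\<forall>x. norm (\<phi> x) \<le> norm x)"
  then interpret lin: Vector_Spaces.linear smul "(*)" \<phi> by blast
  have "\<phi> (r *\<^sub>R x) = r *\<^sub>R \<phi> x" for r x
    using lin.scale[of "of_real r" x] by (simp add: smul_of_real scaleR_conv_of_real)
  then have bl: "bounded_linear \<phi>"
    using * by (intro bounded_linear_intro[where K = 1]) (auto simp: lin.add)
  have "onorm \<phi> \<le> 1" using * by (intro onorm_bound) auto
  with * bl show "\<phi> \<in> dual_ball smul"
    by (simp add: dual_ball_def top_dual_def linear_continuous_on)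
qed

text \<open>The value 1 at a unit vector already forces \<open>onorm \<phi> \<ge> 1\<close>. Thus
  the sphere can be traded for the ball, whose defining conditions are closed under pointwise
  limits.\<close>

lemma (in kbanach) support_functional_iff:
  assumes "norm u = 1"
  shows "\<phi> \<in> dual_sphere smul \<and> \<phi> u = of_real (norm u) \<longleftrightarrow> \<phi> \<in> dual_ball smul \<and> \<phi> u = 1"
proof -
  have "onorm \<phi> = 1" if \<phi>: "\<phi> \<in> dual_ball smul" "\<phi> u = 1"
  proof (rule antisym)
    show "onorm \<phi> \<le> 1" using \<phi> by (simp add: dual_ball_def)
    \<comment> \<open>At \<open>x = 0\<close> the quotient is 0 by the convention for
      division.\<close>
    have "bdd_above (range (\<lambda>x. norm (\<phi> x) / norm x))"
      using \<phi> by (intro bdd_aboveI[where M = 1]) (auto simp: dual_ball_iff divide_le_eq_1)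
    then show "1 \<le> onorm \<phi>"
      unfolding onorm_def using \<phi> assms by (intro cSUP_upper2[where x = u]) auto
  qed
  with assms show ?thesis by (auto simp: dual_sphere_def dual_ball_def)
qed

text \<open>Tychonoff's theorem for the balls of radius \<open>norm x\<close>: the function type
  carries the product topology. Linearity is added later as a closed condition.\<close>

lemma compact_bounded_functions:
  "compact {f :: 'z::real_normed_vector \<Rightarrow> 'k::rc_field. \<forall>x. norm (f x) \<le> norm x}"
proof -
  have "compactin (product_topology (\<lambda>_. euclidean) UNIV) (PiE UNIV (\<lambda>x::'z. cball (0::'k) (norm x)))"
    by (simp add: compactin_PiE compact_cball_rc_field)
  moreover have "PiE UNIV (\<lambda>x::'z. cball (0::'k) (norm x)) = {f. \<forall>x. norm (f x) \<le> norm x}"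
    by auto
  ultimately show ?thesis by (simp add: euclidean_product_topology)
qed

text \<open>The closed sets that eventually contain the sequence have the finite intersection
  property inside \<open>B\<close>. Such a cluster point stands in for the limit of a subsequence,
  which need not exist in a large product.\<close>

lemma compact_seq_cluster_point:
  fixes X :: "nat \<Rightarrow> 'a::topological_space"
  assumes "compact B" and "\<And>n. X n \<in> B"
  shows "\<exists>x\<in>B. \<forall>C. closed C \<longrightarrow> (\<forall>\<^sub>F n in sequentially. X n \<in> C) \<longrightarrow> x \<in> C"
proof -
  define A where "A = {C. closed C \<and> (\<forall>\<^sub>F n in sequentially. X n \<in> C)}"
  have "B \<inter> \<Inter>A \<noteq> {}"
  proof (rule compact_imp_fip[OF assms(1)])
    fix F assume F: "finite F" "F \<subseteq> A"
    then have "\<forall>\<^sub>F n in sequentially. \<forall>C\<in>F. X n \<in> C"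
      by (intro eventually_ball_finite) (auto simp: A_def)
    then obtain n where "\<forall>C\<in>F. X n \<in> C"
      using eventually_happens' sequentially_bot by blast
    with assms(2) show "B \<inter> \<Inter>F \<noteq> {}" by blast
  qed (simp add: A_def)
  then show ?thesis by (auto simp: A_def)
qed

section \<open>Almost norming functionals at a point\<close>

locale norming_at = kbanach smul for smul :: "'k::rc_field \<Rightarrow> 'z::banach \<Rightarrow> 'z" +
  fixes u :: 'z and \<Lambda> :: "('z \<Rightarrow> 'k) set"
  assumes norm_u: "norm u = 1" and norming: "one_norming smul \<Lambda>"
begin

text \<open>The set in (iii). The factor \<open>kcnj (\<psi> n u)\<close> rotates each functional so
  that its value at \<open>u\<close> becomes the square of \<open>norm (\<psi> n u)\<close>, a real
  number tending to 1.\<close>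

definition limit_values :: "'z \<Rightarrow> 'k set" where
  "limit_values z = {l. \<exists>\<psi>. (\<forall>n::nat. \<psi> n \<in> \<Lambda>) \<and>
     (\<lambda>n. norm (\<psi> n u)) \<longlonglongrightarrow> 1 \<and> (\<lambda>n. \<psi> n z * kcnj (\<psi> n u)) \<longlonglongrightarrow> l}"

definition slice_values :: "real \<Rightarrow> 'z \<Rightarrow> 'k set" where
  "slice_values \<delta> z = {\<psi> z * kcnj (\<psi> u) | \<psi>. \<psi> \<in> \<Lambda> \<and> norm (\<psi> u) > 1 - \<delta>}"

lemma dual_ballD: "\<psi> \<in> \<Lambda> \<Longrightarrow> \<psi> \<in> dual_ball smul"
  using norming by (auto simp: one_norming_def)

lemma norm_le: "\<psi> \<in> \<Lambda> \<Longrightarrow> norm (\<psi> x) \<le> norm x"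
  using dual_ballD dual_ball_iff by blast

lemma norm_u_le: "\<psi> \<in> \<Lambda> \<Longrightarrow> norm (\<psi> u) \<le> 1"
  using norm_le[of \<psi> u] norm_u by simp

lemma linear: "\<psi> \<in> \<Lambda> \<Longrightarrow> Vector_Spaces.linear smul (*) \<psi>"
  using dual_ballD dual_ball_iff by blast

lemma norm_value_le:
  assumes "\<psi> \<in> \<Lambda>"
  shows "norm (\<psi> z * kcnj (\<psi> u)) \<le> norm z"
  using mult_mono[OF norm_le[OF assms, of z] norm_u_le[OF assms]] by (simp add: norm_mult)

text \<open>A supremum over the empty set would be the same real at every point, giving
  \<open>u\<close> and zero equal norms.\<close>

lemma nonempty: "\<Lambda> \<noteq> {}"
proof
  assume "\<Lambda> = {}"
  then have "norm u = norm (0::'z)" using norming by (metis image_empty one_norming_def)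
  with norm_u show False by simp
qed

lemma norm_leI:
  assumes "\<And>\<psi>. \<psi> \<in> \<Lambda> \<Longrightarrow> norm (\<psi> z) \<le> B"
  shows "norm z \<le> B"
proof -
  have "(SUP \<phi>\<in>\<Lambda>. norm (\<phi> z)) \<le> B" using assms nonempty by (intro cSUP_least) auto
  then show ?thesis using norming by (simp add: one_norming_def)
qed

lemma almost_norming:
  assumes "\<delta> > 0"
  obtains \<psi> where "\<psi> \<in> \<Lambda>" "norm (\<psi> u) > 1 - \<delta>"
  using norm_leI[of u "1 - \<delta>"] assms norm_u by force

lemma tendsto_norm_u:
  assumes "\<And>n. \<psi> n \<in> \<Lambda>" and "\<And>n. norm (\<psi> n u) > 1 - 1 / real (Suc n)"
  shows "(\<lambda>n. norm (\<psi> n u)) \<longlonglongrightarrow> 1"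
proof (rule tendsto_sandwich)
  show "(\<lambda>n. 1 - 1 / real (Suc n)) \<longlonglongrightarrow> 1"
    using tendsto_diff[OF tendsto_const LIMSEQ_inverse_real_of_nat, of 1]
    by (simp add: inverse_eq_divide)
  show "(\<lambda>n. 1 :: real) \<longlonglongrightarrow> 1" by simp
qed (use norm_u_le[OF assms(1)] less_imp_le[OF assms(2)] in \<open>simp_all add: tendsto_const\<close>)

lemma limit_value_subseq:
  assumes "\<And>n. \<psi> n \<in> \<Lambda>" and "(\<lambda>n. norm (\<psi> n u)) \<longlonglongrightarrow> 1"
  obtains r l where "strict_mono r" "l \<in> limit_values z"
    "(\<lambda>n. \<psi> (r n) z * kcnj (\<psi> (r n) u)) \<longlonglongrightarrow> l"
proof -
  obtain l r where r: "strict_mono r" "((\<lambda>n. \<psi> n z * kcnj (\<psi> n u)) \<circ> r) \<longlonglongrightarrow> l"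
    using bounded_seq_convergent_subseq[of "\<lambda>n. \<psi> n z * kcnj (\<psi> n u)", OF norm_value_le[OF assms(1)]] by blast
  moreover have "(\<lambda>n. norm (\<psi> (r n) u)) \<longlonglongrightarrow> 1"
    using LIMSEQ_subseq_LIMSEQ[OF assms(2) r(1)] by (simp add: o_def)
  ultimately have "l \<in> limit_values z"
    using assms(1) unfolding limit_values_def o_def by (auto intro!: exI[of _ "\<lambda>n. \<psi> (r n)"])
  with r show thesis using that by (simp add: o_def)
qed

lemma limit_values_nonempty: "limit_values z \<noteq> {}"
proof -
  have "\<exists>\<psi>. \<psi> \<in> \<Lambda> \<and> norm (\<psi> u) > 1 - 1 / real (Suc n)" for n
    using almost_norming[of "1 / real (Suc n)"] by auto
  then obtain \<psi> where \<psi>: "\<And>n. \<psi> n \<in> \<Lambda>" "\<And>n. norm (\<psi> n u) > 1 - 1 / real (Suc n)"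
    by metis
  then show ?thesis using limit_value_subseq[OF \<psi>(1) tendsto_norm_u[OF \<psi>], of z] by blast
qed

section \<open>Equality of the sets in (ii), (iii) and (iv)\<close>

text \<open>If \<open>\<psi> n u\<close> tends to the conjugate of a unit scalar, conjugating again
  produces that scalar as the factor of the limit. Conversely only the products are known to
  converge; two successive subsequences make the values at \<open>u\<close> and at \<open>z\<close>
  converge separately, and the conjugate of the limit at \<open>u\<close> is the rotation.\<close>

lemma rotated_limit_values_eq:
  "{\<theta>\<^sub>0 * l | \<theta>\<^sub>0 l \<psi>. (\<forall>n::nat. \<psi> n \<in> \<Lambda>) \<and> norm \<theta>\<^sub>0 = 1 \<and>
     (\<lambda>n. \<psi> n u) \<longlonglongrightarrow> kcnj \<theta>\<^sub>0 \<and> (\<lambda>n. \<psi> n z) \<longlonglongrightarrow> l} = limit_values z"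
  (is "?R = _")
proof (intro set_eqI iffI)
  fix a assume "a \<in> ?R"
  then obtain \<theta> l \<psi> where *: "a = \<theta> * l" "\<And>n::nat. \<psi> n \<in> \<Lambda>" "norm \<theta> = 1"
      "(\<lambda>n. \<psi> n u) \<longlonglongrightarrow> kcnj \<theta>" "(\<lambda>n. \<psi> n z) \<longlonglongrightarrow> l"
    by blast
  have "(\<lambda>n. norm (\<psi> n u)) \<longlonglongrightarrow> 1" using tendsto_norm[OF *(4)] *(3) by simp
  moreover have "(\<lambda>n. \<psi> n z * kcnj (\<psi> n u)) \<longlonglongrightarrow> a"
    using tendsto_mult[OF *(5) tendsto_kcnj[OF *(4)]] *(1) by (simp add: mult.commute)
  ultimately show "a \<in> limit_values z" using *(2) by (auto simp: limit_values_def)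
next
  fix a assume "a \<in> limit_values z"
  then obtain \<psi> where \<psi>: "\<And>n::nat. \<psi> n \<in> \<Lambda>" "(\<lambda>n. norm (\<psi> n u)) \<longlonglongrightarrow> 1"
      "(\<lambda>n. \<psi> n z * kcnj (\<psi> n u)) \<longlonglongrightarrow> a"
    unfolding limit_values_def by blast
  obtain r w where r: "strict_mono r" "((\<lambda>n. \<psi> n u) \<circ> r) \<longlonglongrightarrow> w"
    using bounded_seq_convergent_subseq[of "\<lambda>n. \<psi> n u", OF norm_u_le[OF \<psi>(1)]] by blast
  obtain s l where s: "strict_mono s" "((\<lambda>n. \<psi> (r n) z) \<circ> s) \<longlonglongrightarrow> l"
    using bounded_seq_convergent_subseq[of "\<lambda>n. \<psi> (r n) z", OF norm_le[OF \<psi>(1)]] by blast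
  define \<xi> where "\<xi> n = \<psi> (r (s n))" for n
  have rs: "strict_mono (r \<circ> s)" using r(1) s(1) by (rule strict_mono_o)
  have cu: "(\<lambda>n. \<xi> n u) \<longlonglongrightarrow> w"
    using LIMSEQ_subseq_LIMSEQ[OF r(2) s(1)] by (simp add: o_def \<xi>_def)
  have cz: "(\<lambda>n. \<xi> n z) \<longlonglongrightarrow> l" using s(2) by (simp add: o_def \<xi>_def)
  have "(\<lambda>n. norm (\<xi> n u)) \<longlonglongrightarrow> 1"
    using LIMSEQ_subseq_LIMSEQ[OF \<psi>(2) rs] by (simp add: o_def \<xi>_def)
  then have "norm w = 1" using tendsto_norm[OF cu] LIMSEQ_unique by blast
  moreover have "(\<lambda>n. \<xi> n z * kcnj (\<xi> n u)) \<longlonglongrightarrow> a"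
    using LIMSEQ_subseq_LIMSEQ[OF \<psi>(3) rs] by (simp add: o_def \<xi>_def)
  then have "a = kcnj w * l"
    using tendsto_mult[OF cz tendsto_kcnj[OF cu]] LIMSEQ_unique by (metis mult.commute)
  ultimately show "a \<in> ?R"
    using \<psi>(1) cu cz unfolding mem_Collect_eq
    by (intro exI[of _ "kcnj w"] exI[of _ l] exI[of _ \<xi>]) (simp add: \<xi>_def)
qed

text \<open>A point of the intersection is approximated within \<open>1 / (n + 1)\<close> from the
  slice with \<open>\<delta> = 1 / (n + 1)\<close>. Conversely, a sequence defining a limit value
  eventually enters every slice.\<close>

lemma Inter_closure_slice_values:
  "(\<Inter>\<delta>\<in>{0<..}. closure (slice_values \<delta> z)) = limit_values z"
proof (intro set_eqI iffI)
  fix a assume a: "a \<in> (\<Inter>\<delta>\<in>{0<..}. closure (slice_values \<delta> z))"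
  have "\<exists>\<psi>. \<psi> \<in> \<Lambda> \<and> norm (\<psi> u) > 1 - 1 / real (Suc n) \<and>
      dist (\<psi> z * kcnj (\<psi> u)) a < 1 / real (Suc n)" for n
  proof -
    have "a \<in> closure (slice_values (1 / real (Suc n)) z)" using a by simp
    then obtain y where "y \<in> slice_values (1 / real (Suc n)) z" "dist y a < 1 / real (Suc n)"
      unfolding closure_approachable by (metis of_nat_0_less_iff zero_less_Suc zero_less_divide_1_iff)
    then show ?thesis by (auto simp: slice_values_def)
  qed
  then obtain \<psi> where \<psi>: "\<And>n. \<psi> n \<in> \<Lambda>" "\<And>n. norm (\<psi> n u) > 1 - 1 / real (Suc n)"
      "\<And>n. dist (\<psi> n z * kcnj (\<psi> n u)) a < 1 / real (Suc n)"
    by metis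
  have "(\<lambda>n. \<psi> n z * kcnj (\<psi> n u)) \<longlonglongrightarrow> a"
  proof (rule metric_LIMSEQ_I)
    fix e :: real assume "e > 0"
    then obtain N where N: "1 / real (Suc N) < e" using nat_approx_posE by blast
    have "dist (\<psi> n z * kcnj (\<psi> n u)) a < e" if "n \<ge> N" for n
    proof -
      have "1 / real (Suc n) \<le> 1 / real (Suc N)" using that by (simp add: frac_le)
      then show ?thesis using \<psi>(3)[of n] N by linarith
    qed
    then show "\<exists>N. \<forall>n\<ge>N. dist (\<psi> n z * kcnj (\<psi> n u)) a < e" by blast
  qed
  with \<psi>(1) tendsto_norm_u[OF \<psi>(1,2)] show "a \<in> limit_values z"
    by (auto simp: limit_values_def)
next
  fix a assume "a \<in> limit_values z"
  then obtain \<psi> where \<psi>: "\<And>n::nat. \<psi> n \<in> \<Lambda>" "(\<lambda>n. norm (\<psi> n u)) \<longlonglongrightarrow> 1"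
      "(\<lambda>n. \<psi> n z * kcnj (\<psi> n u)) \<longlonglongrightarrow> a"
    unfolding limit_values_def by blast
  have "a \<in> closure (slice_values \<delta> z)" if "\<delta> > 0" for \<delta>
  proof (rule Lim_in_closed_set[OF closed_closure _ sequentially_bot \<psi>(3)])
    have "\<forall>\<^sub>F n in sequentially. norm (\<psi> n u) > 1 - \<delta>"
      using order_tendstoD(1)[OF \<psi>(2), of "1 - \<delta>"] that by simp
    then show "\<forall>\<^sub>F n in sequentially. \<psi> n z * kcnj (\<psi> n u) \<in> closure (slice_values \<delta> z)"
    proof eventually_elim
      case (elim n)
      then have "\<psi> n z * kcnj (\<psi> n u) \<in> slice_values \<delta> z"
        using \<psi>(1) by (auto simp: slice_values_def)
      then show ?case using closure_subset by blast
    qed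
  qed
  then show "a \<in> (\<Inter>\<delta>\<in>{0<..}. closure (slice_values \<delta> z))" by simp
qed

section \<open>Small slices and their convex hulls\<close>

text \<open>Otherwise functionals with \<open>norm (\<psi> u)\<close> tending to 1 would stay more
  than \<open>\<epsilon>\<close> away from \<open>p\<close>, and a subsequence would produce a limit
  value other than \<open>p\<close>. This uniform form of uniqueness serves both the convex hulls
  and the smoothness proof.\<close>

lemma slice_values_subset_cball:
  assumes "limit_values z = {p}" and "\<epsilon> > 0"
  obtains \<delta> where "\<delta> > 0" "slice_values \<delta> z \<subseteq> cball p \<epsilon>"
proof (rule ccontr)
  assume "\<not> thesis"
  then have "\<not> slice_values (1 / real (Suc n)) z \<subseteq> cball p \<epsilon>" for n
    using that by (metis of_nat_0_less_iff zero_less_Suc zero_less_divide_1_iff)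
  then have "\<exists>\<psi>. \<psi> \<in> \<Lambda> \<and> norm (\<psi> u) > 1 - 1 / real (Suc n) \<and>
      dist p (\<psi> z * kcnj (\<psi> u)) > \<epsilon>" for n
    unfolding slice_values_def by (fastforce simp: not_le)
  then obtain \<psi> where \<psi>: "\<And>n. \<psi> n \<in> \<Lambda>" "\<And>n. norm (\<psi> n u) > 1 - 1 / real (Suc n)"
      "\<And>n. dist p (\<psi> n z * kcnj (\<psi> n u)) > \<epsilon>"
    by metis
  obtain r l where "l \<in> limit_values z" "(\<lambda>n. \<psi> (r n) z * kcnj (\<psi> (r n) u)) \<longlonglongrightarrow> l"
    using limit_value_subseq[OF \<psi>(1) tendsto_norm_u[OF \<psi>(1,2)], of z] by blast
  then have "(\<lambda>n. dist p (\<psi> (r n) z * kcnj (\<psi> (r n) u))) \<longlonglongrightarrow> dist p p"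
    using assms(1) by (intro tendsto_intros) auto
  then have "\<epsilon> \<le> dist p p"
    using \<psi>(3) by (intro LIMSEQ_le_const[where x = "dist p p"]) (auto intro: less_imp_le)
  with assms(2) show False by simp
qed

text \<open>The hulls contain the nonempty set of limit values, which settles one direction. For the
  other, closed balls are convex, so a small slice keeps its hull within any prescribed distance of
  the unique limit value.\<close>

lemma is_singleton_Inter_hull_iff:
  "is_singleton (\<Inter>\<delta>\<in>{0<..}. convex hull (closure (slice_values \<delta> z))) \<longleftrightarrow>
     is_singleton (limit_values z)" (is "is_singleton ?H \<longleftrightarrow> _")
proof -
  have sub: "limit_values z \<subseteq> ?H"
    unfolding Inter_closure_slice_values[symmetric] by (intro INF_mono) (auto intro: hull_inc)
  have "?H \<subseteq> {p}" if p: "limit_values z = {p}" for p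
  proof
    fix x assume x: "x \<in> ?H"
    have "dist p x \<le> \<epsilon>" if \<epsilon>: "\<epsilon> > 0" for \<epsilon>
    proof -
      obtain \<delta> where \<delta>: "\<delta> > 0" "slice_values \<delta> z \<subseteq> cball p \<epsilon>"
        using slice_values_subset_cball[OF p \<epsilon>] by blast
      then have "convex hull (closure (slice_values \<delta> z)) \<subseteq> cball p \<epsilon>"
        by (intro hull_minimal closure_minimal) auto
      with x \<delta>(1) show ?thesis by auto
    qed
    then have "dist p x \<le> 0" by (rule field_le_epsilon) simp
    then show "x \<in> {p}" by simp
  qed
  with sub show ?thesis using limit_values_nonempty[of z] unfolding is_singleton_def
    by (metis subset_singletonD subset_antisym)
qed

section \<open>Limit values as values of support functionals\<close>

text \<open>The rotated functionals \<open>X n\<close> have a cluster point in the product topology.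
  Every property required of it is a closed condition that the \<open>X n\<close> satisfy exactly or
  up to \<open>\<epsilon>\<close> eventually.\<close>

lemma limit_value_attained:
  assumes "a \<in> limit_values z"
  obtains \<phi> where "\<phi> \<in> dual_ball smul" "\<phi> u = 1" "\<phi> z = a"
proof -
  obtain \<psi> where \<psi>: "\<And>n::nat. \<psi> n \<in> \<Lambda>" "(\<lambda>n. norm (\<psi> n u)) \<longlonglongrightarrow> 1"
      "(\<lambda>n. \<psi> n z * kcnj (\<psi> n u)) \<longlonglongrightarrow> a"
    using assms unfolding limit_values_def by blast
  define X where "X n = (\<lambda>x. \<psi> n x * kcnj (\<psi> n u))" for n
  have "norm (X n x) \<le> norm x" for n x
    using norm_value_le[OF \<psi>(1)] by (simp add: X_def)
  then have X: "X n \<in> {f. \<forall>x. norm (f x) \<le> norm x}" for n by simp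
  obtain \<phi> where \<phi>: "\<phi> \<in> {f. \<forall>x. norm (f x) \<le> norm x}"
    and closed: "\<And>C. closed C \<Longrightarrow> (\<forall>\<^sub>F n in sequentially. X n \<in> C) \<Longrightarrow> \<phi> \<in> C"
    using compact_seq_cluster_point[of _ X, OF compact_bounded_functions X] by blast
  have add: "\<phi> (x + y) = \<phi> x + \<phi> y" for x y
  proof -
    have "X n (x + y) = X n x + X n y" for n
      using linear[OF \<psi>(1)[of n]] by (simp add: X_def Vector_Spaces.linear_iff distrib_right)
    moreover have "closed {f :: 'z \<Rightarrow> 'k. f (x + y) = f x + f y}"
      by (intro closed_Collect_eq continuous_intros continuous_on_product_coordinates)
    ultimately show ?thesis using closed[of "{f. f (x + y) = f x + f y}"] by simp
  qed
  have scale: "\<phi> (smul c x) = c * \<phi> x" for c x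
  proof -
    have "X n (smul c x) = c * X n x" for n
      using linear[OF \<psi>(1)[of n]] by (simp add: X_def Vector_Spaces.linear_iff mult.assoc)
    moreover have "closed {f :: 'z \<Rightarrow> 'k. f (smul c x) = c * f x}"
      by (intro closed_Collect_eq continuous_intros continuous_on_product_coordinates)
    ultimately show ?thesis using closed[of "{f. f (smul c x) = c * f x}"] by simp
  qed
  \<comment> \<open>Where the sequence converges, the cluster point takes the limit: the closed
    condition is to be within \<open>\<epsilon>\<close> of \<open>b\<close> at
    \<open>x\<close>.\<close>
  have limit: "\<phi> x = b" if "(\<lambda>n. X n x) \<longlonglongrightarrow> b" for x b
  proof -
    have "dist (\<phi> x) b \<le> \<epsilon>" if "\<epsilon> > 0" for \<epsilon>
    proof -
      have "\<forall>\<^sub>F n in sequentially. dist (X n x) b \<le> \<epsilon>"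
        using tendstoD[OF \<open>(\<lambda>n. X n x) \<longlonglongrightarrow> b\<close> that] by (rule eventually_mono) simp
      moreover have "closed {f :: 'z \<Rightarrow> 'k. dist (f x) b \<le> \<epsilon>}"
        by (intro closed_Collect_le continuous_intros continuous_on_product_coordinates)
      ultimately show ?thesis using closed[of "{f. dist (f x) b \<le> \<epsilon>}"] by simp
    qed
    then have "dist (\<phi> x) b \<le> 0" by (rule field_le_epsilon) simp
    then show ?thesis by simp
  qed
  have "(\<lambda>n. X n u) \<longlonglongrightarrow> 1"
    using tendsto_of_real[OF tendsto_power[OF \<psi>(2), of 2], where 'a='k]
    by (simp add: X_def mult_kcnj)
  then have "\<phi> u = 1" by (rule limit)
  moreover have "\<phi> z = a" using \<psi>(3) by (intro limit) (simp add: X_def)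
  moreover have "vector_space ((*) :: 'k \<Rightarrow> 'k \<Rightarrow> 'k)" by unfold_locales
  then have "\<phi> \<in> dual_ball smul"
    using \<phi> add scale vector_space_axioms by (simp add: dual_ball_iff Vector_Spaces.linear_iff)
  ultimately show thesis using that by blast
qed

section \<open>Uniqueness of the support functional\<close>

text \<open>A first-order comparison at \<open>u\<close>: along \<open>w\<close> the functional
  \<open>\<phi>\<close> grows with slope \<open>c\<^sup>2\<close>, while smallness of the almost
  norming functionals at \<open>y\<close> lets the norm grow only with slope
  \<open>c * \<epsilon>\<close>.\<close>

lemma support_functional_vanishes:
  assumes \<phi>: "\<phi> \<in> dual_ball smul" "\<phi> u = 1"
    and small: "\<And>\<epsilon>. \<epsilon> > 0 \<Longrightarrow> \<exists>\<delta>>0. \<forall>\<psi>\<in>\<Lambda>. norm (\<psi> u) > 1 - \<delta> \<longrightarrow> norm (\<psi> y) \<le> \<epsilon>"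
  shows "\<phi> y = 0"
proof -
  interpret \<phi>: Vector_Spaces.linear smul "(*)" \<phi> using \<phi>(1) dual_ball_iff by blast
  define c where "c = norm (\<phi> y)"
  \<comment> \<open>The conjugate factor makes \<open>\<phi> w\<close> real and nonnegative.\<close>
  define w where "w = smul (kcnj (\<phi> y)) y"
  have \<phi>w: "\<phi> w = of_real (c\<^sup>2)"
    by (simp add: w_def c_def \<phi>.scale mult_kcnj mult.commute)
  have "c * c \<le> c * \<epsilon>" if \<epsilon>: "\<epsilon> > 0" for \<epsilon>
  proof -
    obtain \<delta> where \<delta>: "\<delta> > 0"
        "\<And>\<psi>. \<psi> \<in> \<Lambda> \<Longrightarrow> norm (\<psi> u) > 1 - \<delta> \<Longrightarrow> norm (\<psi> y) \<le> \<epsilon>"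
      using small[OF \<epsilon>] by blast
    \<comment> \<open>With \<open>s * norm w \<le> \<delta>\<close>, a functional of modulus at most
      \<open>1 - \<delta>\<close> at \<open>u\<close> has modulus at most 1 at
      \<open>u + s w\<close>. The summand 1 keeps the denominator positive when
      \<open>w = 0\<close>.\<close>
    define s where "s = \<delta> / (1 + norm w)"
    have pos: "1 + norm w > 0" by (simp add: add_pos_nonneg)
    have s: "s > 0" using \<delta>(1) pos by (simp add: s_def)
    have "s * (1 + norm w) = \<delta>" using pos by (simp add: s_def)
    then have sw: "s * norm w \<le> \<delta>" using s by (simp add: algebra_simps)
    have "norm (u + s *\<^sub>R w) \<le> 1 + s * (c * \<epsilon>)"
    proof (rule norm_leI)
      fix \<psi> assume \<psi>: "\<psi> \<in> \<Lambda>"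
      interpret \<psi>: Vector_Spaces.linear smul "(*)" \<psi> using linear[OF \<psi>] .
      have "\<psi> (u + s *\<^sub>R w) = \<psi> u + of_real s * \<psi> w"
        by (simp add: \<psi>.add \<psi>.scale flip: smul_of_real)
      then have le: "norm (\<psi> (u + s *\<^sub>R w)) \<le> norm (\<psi> u) + s * norm (\<psi> w)"
        using norm_triangle_ineq[of "\<psi> u" "of_real s * \<psi> w"] s by (simp add: norm_mult)
      show "norm (\<psi> (u + s *\<^sub>R w)) \<le> 1 + s * (c * \<epsilon>)"
      proof (cases "norm (\<psi> u) > 1 - \<delta>")
        case True
        then have "norm (\<psi> w) \<le> c * \<epsilon>"
          using \<delta>(2)[OF \<psi>] by (simp add: w_def c_def \<psi>.scale norm_mult mult_left_mono)
        then have "s * norm (\<psi> w) \<le> s * (c * \<epsilon>)" using s by (simp add: mult_left_mono)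
        with le norm_u_le[OF \<psi>] show ?thesis by linarith
      next
        case False
        have "s * norm (\<psi> w) \<le> s * norm w" using norm_le[OF \<psi>] s by (simp add: mult_left_mono)
        moreover have "0 \<le> s * (c * \<epsilon>)" using s \<epsilon> by (simp add: c_def)
        ultimately show ?thesis using False le sw by linarith
      qed
    qed
    moreover have "norm (1 + of_real s * of_real (c\<^sup>2) :: 'k) = 1 + s * c\<^sup>2"
    proof -
      have "1 + of_real s * of_real (c\<^sup>2) = (of_real (1 + s * c\<^sup>2) :: 'k)" by simp
      then show ?thesis using s by (simp only: norm_of_real) simp
    qed
    moreover have "\<phi> (u + s *\<^sub>R w) = 1 + of_real s * of_real (c\<^sup>2)"
      using \<phi>w \<phi>(2) by (simp add: \<phi>.add \<phi>.scale del: of_real_power flip: smul_of_real)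
    moreover have "norm (\<phi> (u + s *\<^sub>R w)) \<le> norm (u + s *\<^sub>R w)"
      using \<phi>(1) dual_ball_iff by blast
    ultimately have "s * c\<^sup>2 \<le> s * (c * \<epsilon>)" by simp
    with s show ?thesis by (simp add: power2_eq_square)
  qed
  moreover have "c \<ge> 0" by (simp add: c_def)
  ultimately have "c \<le> \<epsilon>" if "\<epsilon> > 0" for \<epsilon>
    using that by (metis le_less mult_le_cancel_left_pos)
  then have "c \<le> 0" by (rule field_le_epsilon) simp
  then show ?thesis by (simp add: c_def)
qed

text \<open>At \<open>y = z - p u\<close> the rotated value of an almost norming functional is close
  to \<open>p - p = 0\<close>, so the preceding lemma applies.\<close>

lemma support_functional_eq_limit_value:
  assumes \<phi>: "\<phi> \<in> dual_ball smul" "\<phi> u = 1" and p: "limit_values z = {p}"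
  shows "\<phi> z = p"
proof -
  interpret \<phi>: Vector_Spaces.linear smul "(*)" \<phi> using \<phi>(1) dual_ball_iff by blast
  define y where "y = z - smul p u"
  have "\<phi> y = 0"
  proof (rule support_functional_vanishes[OF \<phi>])
    fix \<epsilon> :: real assume \<epsilon>: "\<epsilon> > 0"
    obtain \<delta> where \<delta>: "\<delta> > 0" "slice_values \<delta> z \<subseteq> cball p (\<epsilon> / 4)"
      using slice_values_subset_cball[OF p, of "\<epsilon> / 4"] \<epsilon> by auto
    \<comment> \<open>The first bound places \<open>\<psi>\<close> in the slice, the second gives
      \<open>norm (\<psi> u) > 1 / 2\<close>, and the third makes
      \<open>norm p * (2 * \<eta>)\<close> at most \<open>\<epsilon> / 4\<close>. Two errors of
      \<open>\<epsilon> / 4\<close>, divided by a modulus above \<open>1 / 2\<close>, then stay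
      within \<open>\<epsilon>\<close>.\<close>
    define \<eta> where "\<eta> = min \<delta> (min (1 / 2) (\<epsilon> / (8 * (1 + norm p))))"
    have pos: "1 + norm p > 0" by (simp add: add_pos_nonneg)
    have \<eta>: "\<eta> > 0" "\<eta> \<le> \<delta>" "\<eta> \<le> 1 / 2" "\<eta> \<le> \<epsilon> / (8 * (1 + norm p))"
      unfolding \<eta>_def using \<delta>(1) \<epsilon> pos by (simp, linarith, linarith, linarith)
    have "\<eta> * (8 * (1 + norm p)) \<le> \<epsilon>" using \<eta>(4) pos by (simp add: pos_le_divide_eq)
    then have \<eta>p: "norm p * (2 * \<eta>) \<le> \<epsilon> / 4" using \<eta>(1) by (simp add: algebra_simps)
    have "norm (\<psi> y) \<le> \<epsilon>" if \<psi>: "\<psi> \<in> \<Lambda>" "norm (\<psi> u) > 1 - \<eta>" for \<psi>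
    proof -
      interpret \<psi>: Vector_Spaces.linear smul "(*)" \<psi> using linear[OF \<psi>(1)] .
      let ?t = "norm (\<psi> u)"
      have "\<psi> z * kcnj (\<psi> u) \<in> slice_values \<delta> z"
        using \<psi> \<eta>(2) by (fastforce simp: slice_values_def)
      then have 1: "norm (\<psi> z * kcnj (\<psi> u) - p) \<le> \<epsilon> / 4"
        using \<delta>(2) by (auto simp: dist_norm norm_minus_commute)
      \<comment> \<open>Expanding the square bounds the defect \<open>1 - ?t\<^sup>2\<close> by
        \<open>2 * \<eta>\<close>, up to the discarded term
        \<open>- \<eta> * \<eta>\<close>.\<close>
      have "(1 - \<eta>) * (1 - \<eta>) \<le> ?t * ?t" using \<psi>(2) \<eta>(3) by (intro mult_mono) auto
      then have "1 - ?t\<^sup>2 \<le> 2 * \<eta>"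
        using zero_le_square[of \<eta>] by (simp only: power2_eq_square algebra_simps)
      moreover have "?t\<^sup>2 \<le> 1" using norm_u_le[OF \<psi>(1)] by (simp add: power_le_one)
      ultimately have "norm (of_real (1 - ?t\<^sup>2) :: 'k) \<le> 2 * \<eta>" by (simp only: norm_of_real)
      then have "norm (p * of_real (1 - ?t\<^sup>2)) \<le> norm p * (2 * \<eta>)"
        unfolding norm_mult by (intro mult_left_mono) auto
      then have 2: "norm (p * of_real (1 - ?t\<^sup>2)) \<le> \<epsilon> / 4" using \<eta>p by linarith
      have "\<psi> y * kcnj (\<psi> u) = (\<psi> z * kcnj (\<psi> u) - p) + p * of_real (1 - ?t\<^sup>2)"
      proof -
        have "\<psi> y * kcnj (\<psi> u) = \<psi> z * kcnj (\<psi> u) - p * (\<psi> u * kcnj (\<psi> u))"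
          by (simp add: y_def \<psi>.diff \<psi>.scale algebra_simps)
        then show ?thesis by (simp add: mult_kcnj algebra_simps)
      qed
      then have "norm (\<psi> y) * ?t \<le> \<epsilon> / 4 + \<epsilon> / 4"
        using norm_triangle_mono[OF 1 2] by (metis norm_mult norm_kcnj)
      moreover have "norm (\<psi> y) * (1 / 2) \<le> norm (\<psi> y) * ?t"
        using \<psi>(2) \<eta>(3) by (intro mult_left_mono) auto
      ultimately show ?thesis by linarith
    qed
    with \<eta>(1) show "\<exists>\<delta>>0. \<forall>\<psi>\<in>\<Lambda>. norm (\<psi> u) > 1 - \<delta> \<longrightarrow> norm (\<psi> y) \<le> \<epsilon>" by blast
  qed
  then show ?thesis using \<phi>(2) by (simp add: y_def \<phi>.diff \<phi>.scale)
qed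

text \<open>A unique support functional fixes every limit value, since each is attained by such a
  functional. Conversely, the map \<open>p\<close> sending \<open>z\<close> to its only limit value
  must itself be the support functional.\<close>

lemma smooth_point_iff: "smooth_point smul u \<longleftrightarrow> (\<forall>z. is_singleton (limit_values z))"
proof -
  have smooth: "smooth_point smul u \<longleftrightarrow> (\<exists>\<phi>\<^sub>0. {\<phi> \<in> dual_ball smul. \<phi> u = 1} = {\<phi>\<^sub>0})"
    unfolding smooth_point_def is_singleton_def support_functional_iff[OF norm_u] ..
  show ?thesis
  proof
    assume "smooth_point smul u"
    then obtain \<phi>\<^sub>0 where "{\<phi> \<in> dual_ball smul. \<phi> u = 1} = {\<phi>\<^sub>0}" using smooth by blast
    then have \<phi>\<^sub>0: "\<phi> = \<phi>\<^sub>0" if "\<phi> \<in> dual_ball smul" "\<phi> u = 1" for \<phi>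
      using that by blast
    have "a = \<phi>\<^sub>0 z" if a: "a \<in> limit_values z" for a z
    proof -
      obtain \<phi> where "\<phi> \<in> dual_ball smul" "\<phi> u = 1" "\<phi> z = a"
        using limit_value_attained[OF a] .
      with \<phi>\<^sub>0 show ?thesis by metis
    qed
    then show "\<forall>z. is_singleton (limit_values z)"
      using limit_values_nonempty by (metis is_singletonI')
  next
    assume "\<forall>z. is_singleton (limit_values z)"
    then obtain p where p: "\<And>z. limit_values z = {p z}" unfolding is_singleton_def by metis
    then have "\<phi> = p" if "\<phi> \<in> dual_ball smul" "\<phi> u = 1" for \<phi>
      using support_functional_eq_limit_value that by blast
    \<comment> \<open>So far at most one support functional exists; the limit value at
      \<open>u\<close> supplies one.\<close>
    moreover obtain \<phi>\<^sub>0 where "\<phi>\<^sub>0 \<in> dual_ball smul" "\<phi>\<^sub>0 u = 1"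
      using limit_value_attained[of "p u" u] p by blast
    ultimately have "{\<phi> \<in> dual_ball smul. \<phi> u = 1} = {p}" by blast
    then show "smooth_point smul u" using smooth by blast
  qed
qed

end

theorem corollary2p11:
  fixes smul :: "'k::rc_field \<Rightarrow> 'z::banach \<Rightarrow> 'z"
    and u :: 'z and \<Lambda> :: "('z \<Rightarrow> 'k) set"
  assumes "kbanach smul"
    and "u \<in> sphere 0 1"
    and "one_norming smul \<Lambda>"
  shows
    "(smooth_point smul u \<longleftrightarrow>
        (\<forall>z. is_singleton {\<theta>\<^sub>0 * l | \<theta>\<^sub>0 l \<psi>. (\<forall>n::nat. \<psi> n \<in> \<Lambda>) \<and> norm \<theta>\<^sub>0 = 1 \<and>
              (\<lambda>n. \<psi> n u) \<longlonglongrightarrow> kcnj \<theta>\<^sub>0 \<and> (\<lambda>n. \<psi> n z) \<longlonglongrightarrow> l})) \<and>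
     (smooth_point smul u \<longleftrightarrow>
        (\<forall>z. is_singleton {l. \<exists>\<psi>. (\<forall>n::nat. \<psi> n \<in> \<Lambda>) \<and>
              (\<lambda>n. norm (\<psi> n u)) \<longlonglongrightarrow> 1 \<and> (\<lambda>n. \<psi> n z * kcnj (\<psi> n u)) \<longlonglongrightarrow> l})) \<and>
     (smooth_point smul u \<longleftrightarrow>
        (\<forall>z. is_singleton (\<Inter>\<delta>\<in>{0::real<..}.
              closure {\<psi> z * kcnj (\<psi> u) | \<psi>. \<psi> \<in> \<Lambda> \<and> norm (\<psi> u) > 1 - \<delta>}))) \<and>
     (smooth_point smul u \<longleftrightarrow>
        (\<forall>z. is_singleton (\<Inter>\<delta>\<in>{0::real<..}.
              convex hull (closure {\<psi> z * kcnj (\<psi> u) | \<psi>. \<psi> \<in> \<Lambda> \<and> norm (\<psi> u) > 1 - \<delta>}))))"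
proof -
  interpret norming_at smul u \<Lambda>
    using assms by (simp add: norming_at_def norming_at_axioms_def)
  show ?thesis
    \<comment> \<open>All four conditions turn into uniqueness of limit values at every
      \<open>z\<close>.\<close>
    unfolding rotated_limit_values_eq slice_values_def[symmetric] limit_values_def[symmetric]
      Inter_closure_slice_values is_singleton_Inter_hull_iff
    by (simp add: smooth_point_iff)
qed

end
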